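(* Let $(Y,\tau)$ be a topological space and $(Z,\mathcal{U})$ a uniform space. A topology $\mathbb{T}$ on $\mathcal{O}_Z(Y)$ is splitting if and only if its dual topology $\mathfrak{T}(\mathbb{T})$ on $EC(Y,Z)$ is splitting.
   Context: Uniform spaces $(Z,\mathcal{U})$ are given in the usual sense by a family $\mathcal{U}$ of entourages on a non-empty set $Z$. For $U\in\mathcal{U}$ and $z\in Z$, $U[z]=\{w\in Z : (z,w)\in U\}$. Equi-continuity: a function $f:(X,\tau)\to(Z,\mathcal{U})$ from a topological space to a uniform space is equi-continuous at $x\in X$ if for each $U\in\mathcal{U}$ there is an open neighbourhood $V$ of $x$ with $f(V)\subseteq U[f(x)]$; it is equi-continuous if this holds at all $x\in X$. $EC(Y,Z)$ is the set of all equi-continuous functions from $Y$ to $Z$. The set $\mathcal{O}_Z(Y)$: for each $U\in\mathcal{U}$, $f\in EC(Y,Z)$, $y\in Y$ fix an open neighbourhood of $y$ in $Y$, denoted $U(f,y)$, with $f(U(f,y))\subseteq U[f(y)]$ (it exists by equi-continuity). Put $\mathcal{O}_Z(Y)=\{U(f,y) : U\in\mathcal{U}, f\in EC(Y,Z), y\in Y\}$. Dual topology: for $\mathbb{H}\subseteq\mathcal{O}_Z(Y)$ and $U\in\mathcal{U}$ let $(\mathbb{H},U)=\{f\in EC(Y,Z) : U(f,y)\in\mathbb{H}\text{ for each }y\in Y\}$. For a topology $\mathbb{T}$ on $\mathcal{O}_Z(Y)$, its dual $\mathfrak{T}(\mathbb{T})$ is the topology on $EC(Y,Z)$ generated by the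 subbasis $\{(\mathbb{H},U) : \mathbb{H}\in\mathbb{T}, U\in\mathcal{U}\}$. Associated maps: for a topological space $X$, maps $g:X\times Y\to Z$ and $g^*:X\to EC(Y,Z)$ are associated if $g^*(x)(y)=g(x,y)$ for all $x\in X$, $y\in Y$ (if $g$ is equi-continuous on the product space $X\times Y$, each $g(x,\cdot)$ lies in $EC(Y,Z)$). For associated $g,g^*$ define the multifunction $\overline{g}:X\times\mathcal{U}\to\mathcal{O}_Z(Y)$ by $\overline{g}(x,U)=\{U(g^*(x),y) : y\in Y\}$. Upper semi continuity: a multifunction $F:X\to W$ between topological spaces is upper semi continuous if for each $x\in X$ and each open $V\subseteq W$ with $F(x)\subseteq V$ there is an open $O\ni x$ with $F(x')\subseteq V$ for all $x'\in O$. A multifunction $M:X\times\mathcal{U}\to\mathcal{O}_Z(Y)$ is upper semi continuous with respect to the first variable if for every fixed $U\in\mathcal{U}$ the multifunction $M_U:X\to\mathcal{O}_Z(Y)$, $M_U(x)=M(x,U)$, is upper semi continuous. Splitting: a topology $\mathfrak{T}$ on $EC(Y,Z)$ is splitting if for each topological space $(X,\mu)$, equi-continuity of a map $g:X\times Y\to Z$ implies continuity of its associated map $g^*:X\to(EC(Y,Z),\mathfrak{T})$. A topology $\mathbb{T}$ on $\mathcal{O}_Z(Y)$ is splitting if for each topological space $(X,\mu)$, equi-continuity of a map $g:X\times Y\to Z$ implies upper semi continuity with respect to the first variable of $\overline{g}:X\times\mathcal{U}\to(\mathcal{O}_Z(Y),\mathbb{T})$. *)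

theory Defs
  imports "HOL-Analysis.Analysis"
begin

text \<open>
  Topological spaces and uniform spaces are given by explicit carriers: a space \<open>Y\<close> is a value of
  type \<open>'y topology\<close> with points \<open>topspace Y\<close>, and a uniform space is a carrier set \<open>Z\<close>
  with a family \<open>\<U>\<close> of entourages. Maps out of \<open>Y\<close> that are themselves treated as points are
  extensional functions, so that two of them are equal iff they agree on \<open>topspace Y\<close>.
\<close>

definition uniform_structure :: "'z set \<Rightarrow> ('z \<times> 'z) set set \<Rightarrow> bool" where
  "uniform_structure Z \<U> \<longleftrightarrow>
     Z \<noteq> {} \<and> \<U> \<noteq> {} \<and>
     (\<forall>U\<in>\<U>. U \<subseteq> Z \<times> Z \<and> Id_on Z \<subseteq> U) \<and>
     (\<forall>U\<in>\<U>. \<forall>V. U \<subseteq> V \<and> V \<subseteq> Z \<times> Z \<longrightarrow> V \<in> \<U>) \<and>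
     (\<forall>U\<in>\<U>. \<forall>V\<in>\<U>. U \<inter> V \<in> \<U>) \<and>
     (\<forall>U\<in>\<U>. U\<inverse> \<in> \<U>) \<and>
     (\<forall>U\<in>\<U>. \<exists>V\<in>\<U>. V O V \<subseteq> U)"

lemma uniform_structure_UNIV:
  "uniform_structure (UNIV :: 'z::uniform_space set)
     {U. eventually (\<lambda>p. p \<in> U) (uniformity :: ('z \<times> 'z) filter)}"
  unfolding uniform_structure_def
proof (intro conjI ballI allI impI)
  show "{U. eventually (\<lambda>p. p \<in> U) (uniformity :: ('z \<times> 'z) filter)} \<noteq> {}"
    by (auto intro!: exI[of _ UNIV])
next
  fix U assume "U \<in> {U. eventually (\<lambda>p. p \<in> U) (uniformity :: ('z \<times> 'z) filter)}"
  then have U: "eventually (\<lambda>p. p \<in> U) (uniformity :: ('z \<times> 'z) filter)" by simp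
  show "Id_on UNIV \<subseteq> U" using uniformity_refl[OF U] by (auto simp: Id_on_def)
  show "U\<inverse> \<in> {U. eventually (\<lambda>p. p \<in> U) (uniformity :: ('z \<times> 'z) filter)}"
    using uniformity_sym[OF U] by (auto elim!: eventually_mono)
  from uniformity_trans[OF U] obtain D where D: "eventually D (uniformity :: ('z \<times> 'z) filter)"
    "\<And>x y z. D (x, y) \<Longrightarrow> D (y, z) \<Longrightarrow> (x, z) \<in> U" by blast
  then show "\<exists>V\<in>{U. eventually (\<lambda>p. p \<in> U) (uniformity :: ('z \<times> 'z) filter)}. V O V \<subseteq> U"
    by (intro bexI[of _ "Collect D"]) auto
next
  fix U V assume "U \<in> {U. eventually (\<lambda>p. p \<in> U) (uniformity :: ('z \<times> 'z) filter)}"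
    "U \<subseteq> V \<and> V \<subseteq> UNIV \<times> UNIV"
  then show "V \<in> {U. eventually (\<lambda>p. p \<in> U) (uniformity :: ('z \<times> 'z) filter)}"
    by (auto elim!: eventually_mono)
next
  fix U V assume "U \<in> {U. eventually (\<lambda>p. p \<in> U) (uniformity :: ('z \<times> 'z) filter)}"
    "V \<in> {U. eventually (\<lambda>p. p \<in> U) (uniformity :: ('z \<times> 'z) filter)}"
  then show "U \<inter> V \<in> {U. eventually (\<lambda>p. p \<in> U) (uniformity :: ('z \<times> 'z) filter)}"
    by (auto intro: eventually_conj)
qed auto

definition equi_continuous_at ::
  "'x topology \<Rightarrow> ('z \<times> 'z) set set \<Rightarrow> ('x \<Rightarrow> 'z) \<Rightarrow> 'x \<Rightarrow> bool" where
  "equi_continuous_at X \<U> f x \<longleftrightarrow>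
     (\<forall>U\<in>\<U>. \<exists>V. openin X V \<and> x \<in> V \<and> f ` V \<subseteq> U `` {f x})"

definition equi_continuous ::
  "'x topology \<Rightarrow> 'z set \<Rightarrow> ('z \<times> 'z) set set \<Rightarrow> ('x \<Rightarrow> 'z) \<Rightarrow> bool" where
  "equi_continuous X Z \<U> f \<longleftrightarrow>
     f \<in> topspace X \<rightarrow> Z \<and> (\<forall>x\<in>topspace X. equi_continuous_at X \<U> f x)"

definition EC :: "'y topology \<Rightarrow> 'z set \<Rightarrow> ('z \<times> 'z) set set \<Rightarrow> ('y \<Rightarrow> 'z) set" where
  "EC Y Z \<U> = {f \<in> topspace Y \<rightarrow>\<^sub>E Z. equi_continuous Y Z \<U> f}"

text \<open>\<open>N U f y\<close> is the fixed open neighbourhood written \<open>U(f,y)\<close>.\<close>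

definition neighbourhood_choice ::
  "'y topology \<Rightarrow> 'z set \<Rightarrow> ('z \<times> 'z) set set
    \<Rightarrow> (('z \<times> 'z) set \<Rightarrow> ('y \<Rightarrow> 'z) \<Rightarrow> 'y \<Rightarrow> 'y set) \<Rightarrow> bool" where
  "neighbourhood_choice Y Z \<U> N \<longleftrightarrow>
     (\<forall>U\<in>\<U>. \<forall>f\<in>EC Y Z \<U>. \<forall>y\<in>topspace Y.
        openin Y (N U f y) \<and> y \<in> N U f y \<and> f ` N U f y \<subseteq> U `` {f y})"

definition OZ ::
  "'y topology \<Rightarrow> 'z set \<Rightarrow> ('z \<times> 'z) set set
    \<Rightarrow> (('z \<times> 'z) set \<Rightarrow> ('y \<Rightarrow> 'z) \<Rightarrow> 'y \<Rightarrow> 'y set) \<Rightarrow> 'y set set" where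
  "OZ Y Z \<U> N = {N U f y | U f y. U \<in> \<U> \<and> f \<in> EC Y Z \<U> \<and> y \<in> topspace Y}"

definition dual_set ::
  "'y topology \<Rightarrow> 'z set \<Rightarrow> ('z \<times> 'z) set set
    \<Rightarrow> (('z \<times> 'z) set \<Rightarrow> ('y \<Rightarrow> 'z) \<Rightarrow> 'y \<Rightarrow> 'y set)
    \<Rightarrow> 'y set set \<Rightarrow> ('z \<times> 'z) set \<Rightarrow> ('y \<Rightarrow> 'z) set" where
  "dual_set Y Z \<U> N H U = {f \<in> EC Y Z \<U>. \<forall>y\<in>topspace Y. N U f y \<in> H}"

definition dual_topology ::
  "'y topology \<Rightarrow> 'z set \<Rightarrow> ('z \<times> 'z) set set
    \<Rightarrow> (('z \<times> 'z) set \<Rightarrow> ('y \<Rightarrow> 'z) \<Rightarrow> 'y \<Rightarrow> 'y set)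
    \<Rightarrow> 'y set topology \<Rightarrow> ('y \<Rightarrow> 'z) topology" where
  "dual_topology Y Z \<U> N T =
     topology_generated_by {dual_set Y Z \<U> N H U | H U. openin T H \<and> U \<in> \<U>}"

lemma topspace_dual_topology:
  assumes "\<U> \<noteq> {}" and "topspace T = OZ Y Z \<U> N"
  shows "topspace (dual_topology Y Z \<U> N T) = EC Y Z \<U>"
proof -
  obtain U where U: "U \<in> \<U>" using assms(1) by blast
  have "dual_set Y Z \<U> N (topspace T) U = EC Y Z \<U>"
    using U unfolding assms(2) dual_set_def OZ_def by blast
  then have "EC Y Z \<U> \<in> {dual_set Y Z \<U> N H U | H U. openin T H \<and> U \<in> \<U>}"
    using U by (metis (mono_tags, lifting) mem_Collect_eq openin_topspace)
  moreover have "dual_set Y Z \<U> N H U \<subseteq> EC Y Z \<U>" for H U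
    by (auto simp: dual_set_def)
  ultimately show ?thesis unfolding dual_topology_def by auto
qed

definition assoc_map :: "'y topology \<Rightarrow> ('x \<times> 'y \<Rightarrow> 'z) \<Rightarrow> 'x \<Rightarrow> 'y \<Rightarrow> 'z" where
  "assoc_map Y g x = (\<lambda>y\<in>topspace Y. g (x, y))"

definition assoc_multi ::
  "'y topology \<Rightarrow> (('z \<times> 'z) set \<Rightarrow> ('y \<Rightarrow> 'z) \<Rightarrow> 'y \<Rightarrow> 'y set)
    \<Rightarrow> ('x \<times> 'y \<Rightarrow> 'z) \<Rightarrow> 'x \<Rightarrow> ('z \<times> 'z) set \<Rightarrow> 'y set set" where
  "assoc_multi Y N g x U = {N U (assoc_map Y g x) y | y. y \<in> topspace Y}"

definition upper_semi_continuous ::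
  "'x topology \<Rightarrow> 'w topology \<Rightarrow> ('x \<Rightarrow> 'w set) \<Rightarrow> bool" where
  "upper_semi_continuous X W F \<longleftrightarrow>
     (\<forall>x\<in>topspace X. \<forall>V. openin W V \<and> F x \<subseteq> V \<longrightarrow>
        (\<exists>S. openin X S \<and> x \<in> S \<and> (\<forall>x'\<in>S. F x' \<subseteq> V)))"

definition upper_semi_continuous_fst ::
  "'x topology \<Rightarrow> 'u set \<Rightarrow> 'w topology \<Rightarrow> ('x \<Rightarrow> 'u \<Rightarrow> 'w set) \<Rightarrow> bool" where
  "upper_semi_continuous_fst X \<U> W M \<longleftrightarrow>
     (\<forall>U\<in>\<U>. upper_semi_continuous X W (\<lambda>x. M x U))"

text \<open>
  A formula cannot quantify over types, so the two splitting notions carry the type \<open>'x\<close> of the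
  points of the test spaces \<open>X\<close> as a parameter. By \<open>splitting_EC_all_types\<close> and
  \<open>splitting_OZ_all_types\<close> below, the instance \<open>'x = 'y \<Rightarrow> 'z\<close> already covers test spaces of
  every type.
\<close>

definition splitting_EC ::
  "'x itself \<Rightarrow> 'y topology \<Rightarrow> 'z set \<Rightarrow> ('z \<times> 'z) set set \<Rightarrow> ('y \<Rightarrow> 'z) topology \<Rightarrow> bool" where
  "splitting_EC (_ :: 'x itself) Y Z \<U> T \<longleftrightarrow>
     (\<forall>(X :: 'x topology) g.
        equi_continuous (prod_topology X Y) Z \<U> g \<longrightarrow> continuous_map X T (assoc_map Y g))"

definition splitting_OZ ::
  "'x itself \<Rightarrow> 'y topology \<Rightarrow> 'z set \<Rightarrow> ('z \<times> 'z) set set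
    \<Rightarrow> (('z \<times> 'z) set \<Rightarrow> ('y \<Rightarrow> 'z) \<Rightarrow> 'y \<Rightarrow> 'y set) \<Rightarrow> 'y set topology \<Rightarrow> bool" where
  "splitting_OZ (_ :: 'x itself) Y Z \<U> N T \<longleftrightarrow>
     (\<forall>(X :: 'x topology) g.
        equi_continuous (prod_topology X Y) Z \<U> g \<longrightarrow>
        upper_semi_continuous_fst X \<U> T (assoc_multi Y N g))"

lemma assoc_map_in_EC:
  assumes g: "equi_continuous (prod_topology X Y) Z \<U> g" and x: "x \<in> topspace X"
  shows "assoc_map Y g x \<in> EC Y Z \<U>"
proof -
  have gZ: "g (x, y) \<in> Z" if "y \<in> topspace Y" for y
    using g x that by (auto simp: equi_continuous_def)
  have "equi_continuous_at Y \<U> (assoc_map Y g x) y" if y: "y \<in> topspace Y" for y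
    unfolding equi_continuous_at_def
  proof
    fix U assume "U \<in> \<U>"
    with g x y obtain W where W: "openin (prod_topology X Y) W" "(x, y) \<in> W"
      "g ` W \<subseteq> U `` {g (x, y)}"
      unfolding equi_continuous_def equi_continuous_at_def by fastforce
    then obtain A B where AB: "openin X A" "openin Y B" "x \<in> A" "y \<in> B" "A \<times> B \<subseteq> W"
      by (metis openin_prod_topology_alt)
    have "assoc_map Y g x ` B \<subseteq> U `` {assoc_map Y g x y}"
    proof (rule image_subsetI)
      fix b assume b: "b \<in> B"
      then have "b \<in> topspace Y" using AB(2) openin_subset by blast
      moreover have "g (x, b) \<in> U `` {g (x, y)}" using W(3) AB b by blast
      ultimately show "assoc_map Y g x b \<in> U `` {assoc_map Y g x y}"
        using y by (simp add: assoc_map_def)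
    qed
    with AB show "\<exists>V. openin Y V \<and> y \<in> V \<and> assoc_map Y g x ` V \<subseteq> U `` {assoc_map Y g x y}"
      by blast
  qed
  then show ?thesis using gZ
    by (auto simp: EC_def equi_continuous_def assoc_map_def)
qed

text \<open>
  The behaviour of \<open>g\<close> at one point \<open>x0\<close> is reproduced by a test space whose points are the
  functions \<open>assoc_map Y g x\<close>: all points other than \<open>assoc_map Y g x0\<close> are isolated, and the
  neighbourhoods of the latter are the images of the neighbourhoods of \<open>x0\<close>.
\<close>

lemma localize_test_space:
  fixes X :: "'x topology" and Y :: "'y topology" and Z :: "'z set"
  assumes g: "equi_continuous (prod_topology X Y) Z \<U> g" and x0: "x0 \<in> topspace X"
  obtains X' :: "('y \<Rightarrow> 'z) topology" where
    "topspace X' = assoc_map Y g ` topspace X"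
    "equi_continuous (prod_topology X' Y) Z \<U> (\<lambda>(f, y). f y)"
    "\<forall>f\<in>topspace X'. assoc_map Y (\<lambda>(f, y). f y) f = f"
    "\<forall>S. openin X' S \<and> assoc_map Y g x0 \<in> S \<longrightarrow>
        (\<exists>A. openin X A \<and> x0 \<in> A \<and> assoc_map Y g ` A \<subseteq> S)"
proof -
  define h where "h = assoc_map Y g"
  define P where "P = (\<lambda>S. S \<subseteq> h ` topspace X \<and>
     (h x0 \<in> S \<longrightarrow> (\<exists>A. openin X A \<and> x0 \<in> A \<and> h ` A \<subseteq> S)))"
  have "istopology P"
    unfolding istopology_def
  proof (intro conjI allI impI)
    fix S T assume "P S" "P T"
    show "P (S \<inter> T)"
      unfolding P_def
    proof (intro conjI impI)
      show "S \<inter> T \<subseteq> h ` topspace X" using \<open>P S\<close> by (auto simp: P_def)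
      assume "h x0 \<in> S \<inter> T"
      with \<open>P S\<close> \<open>P T\<close> obtain A B where "openin X A" "x0 \<in> A" "h ` A \<subseteq> S"
        "openin X B" "x0 \<in> B" "h ` B \<subseteq> T" unfolding P_def by blast
      then show "\<exists>A. openin X A \<and> x0 \<in> A \<and> h ` A \<subseteq> S \<inter> T"
        by (intro exI[of _ "A \<inter> B"]) auto
    qed
  next
    fix K assume K: "\<forall>S\<in>K. P S"
    show "P (\<Union>K)" unfolding P_def
    proof (intro conjI impI)
      show "\<Union>K \<subseteq> h ` topspace X" using K unfolding P_def by blast
      assume "h x0 \<in> \<Union>K"
      then obtain S where "S \<in> K" "h x0 \<in> S" by blast
      with K obtain A where "openin X A" "x0 \<in> A" "h ` A \<subseteq> S" unfolding P_def by blast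
      with \<open>S \<in> K\<close> show "\<exists>A. openin X A \<and> x0 \<in> A \<and> h ` A \<subseteq> \<Union>K" by blast
    qed
  qed
  then have opn: "openin (topology P) = P" by simp
  have "P (h ` topspace X)" unfolding P_def using x0 by blast
  then have "h ` topspace X \<subseteq> topspace (topology P)"
    using openin_subset[of "topology P" "h ` topspace X"] by (simp only: opn)
  moreover have "P (topspace (topology P))"
    using openin_topspace[of "topology P"] by (simp only: opn)
  then have "topspace (topology P) \<subseteq> h ` topspace X" by (simp only: P_def)
  ultimately have top: "topspace (topology P) = h ` topspace X" by (rule equalityI[rotated])
  have hEC: "h x \<in> EC Y Z \<U>" if "x \<in> topspace X" for x
    unfolding h_def by (rule assoc_map_in_EC[OF g that])
  have at: "equi_continuous_at (prod_topology (topology P) Y) \<U> (\<lambda>(f, y). f y) (f, y)"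
    if f: "f \<in> h ` topspace X" and y: "y \<in> topspace Y" for f y
    unfolding equi_continuous_at_def
  proof
    fix U assume U: "U \<in> \<U>"
    have "\<exists>S B. P S \<and> openin Y B \<and> f \<in> S \<and> y \<in> B \<and> (\<lambda>(f, y). f y) ` (S \<times> B) \<subseteq> U `` {f y}"
    proof (cases "f = h x0")
      case False
      have "f \<in> EC Y Z \<U>" using f hEC by blast
      with U y obtain B where "openin Y B" "y \<in> B" "f ` B \<subseteq> U `` {f y}"
        unfolding EC_def equi_continuous_def equi_continuous_at_def by blast
      with False f show ?thesis
        by (intro exI[of _ "{f}"] exI[of _ B]) (auto simp: P_def)
    next
      case True
      from g x0 y U obtain W where W: "openin (prod_topology X Y) W" "(x0, y) \<in> W"
        "g ` W \<subseteq> U `` {g (x0, y)}"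
        unfolding equi_continuous_def equi_continuous_at_def by fastforce
      then obtain A B where AB: "openin X A" "openin Y B" "x0 \<in> A" "y \<in> B" "A \<times> B \<subseteq> W"
        by (metis openin_prod_topology_alt)
      have "P (h ` A)" unfolding P_def using AB openin_subset by blast
      moreover have "(\<lambda>(f, y). f y) ` (h ` A \<times> B) \<subseteq> U `` {f y}"
      proof -
        have "h a b \<in> U `` {f y}" if "a \<in> A" "b \<in> B" for a b
        proof -
          have "b \<in> topspace Y" using AB(2) that openin_subset by blast
          moreover have "g (a, b) \<in> U `` {g (x0, y)}" using W(3) AB that by blast
          ultimately show ?thesis using y by (simp add: True h_def assoc_map_def)
        qed
        then show ?thesis by auto
      qed
      ultimately show ?thesis using AB True by blast
    qed
    then obtain S B where "P S" "openin Y B" "f \<in> S" "y \<in> B"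
      "(\<lambda>(f, y). f y) ` (S \<times> B) \<subseteq> U `` {f y}" by blast
    then show "\<exists>V. openin (prod_topology (topology P) Y) V \<and> (f, y) \<in> V \<and>
        (\<lambda>(f, y). f y) ` V \<subseteq> U `` {case (f, y) of (f, y) \<Rightarrow> f y}"
      by (intro exI[of _ "S \<times> B"]) (auto simp: openin_prod_Times_iff opn)
  qed
  have "equi_continuous (prod_topology (topology P) Y) Z \<U> (\<lambda>(f, y). f y)"
    unfolding equi_continuous_def
  proof (intro conjI ballI)
    show "(\<lambda>(f, y). f y) \<in> topspace (prod_topology (topology P) Y) \<rightarrow> Z"
      using hEC by (fastforce simp: top EC_def equi_continuous_def)
    fix p assume "p \<in> topspace (prod_topology (topology P) Y)"
    then show "equi_continuous_at (prod_topology (topology P) Y) \<U> (\<lambda>(f, y). f y) p"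
      using at by (auto simp: top)
  qed
  moreover have "\<forall>f\<in>topspace (topology P). assoc_map Y (\<lambda>(f, y). f y) f = f"
    unfolding top by (auto simp: h_def assoc_map_def fun_eq_iff)
  moreover have "\<forall>S. openin (topology P) S \<and> assoc_map Y g x0 \<in> S \<longrightarrow>
      (\<exists>A. openin X A \<and> x0 \<in> A \<and> assoc_map Y g ` A \<subseteq> S)"
    unfolding opn by (simp add: P_def h_def)
  ultimately show ?thesis by (rule that[OF top[unfolded h_def]])
qed

lemma splitting_EC_all_types:
  fixes Y :: "'y topology" and Z :: "'z set"
  assumes "splitting_EC TYPE('y \<Rightarrow> 'z) Y Z \<U> T"
  shows "splitting_EC TYPE('x) Y Z \<U> T"
  unfolding splitting_EC_def
proof (intro allI impI)
  fix X :: "'x topology" and g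
  assume g: "equi_continuous (prod_topology X Y) Z \<U> g"
  have loc: "assoc_map Y g x0 \<in> topspace T \<and> (\<forall>W. openin T W \<and> assoc_map Y g x0 \<in> W \<longrightarrow>
      (\<exists>A. openin X A \<and> x0 \<in> A \<and> assoc_map Y g ` A \<subseteq> W))" if x0: "x0 \<in> topspace X" for x0
  proof -
    obtain X' :: "('y \<Rightarrow> 'z) topology" where X':
      "topspace X' = assoc_map Y g ` topspace X"
      "equi_continuous (prod_topology X' Y) Z \<U> (\<lambda>(f, y). f y)"
      "\<forall>f\<in>topspace X'. assoc_map Y (\<lambda>(f, y). f y) f = f"
      "\<forall>S. openin X' S \<and> assoc_map Y g x0 \<in> S \<longrightarrow>
        (\<exists>A. openin X A \<and> x0 \<in> A \<and> assoc_map Y g ` A \<subseteq> S)"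
      by (rule localize_test_space[OF g x0])
    have "continuous_map X' T (assoc_map Y (\<lambda>(f, y). f y))"
      using assms X'(2) by (simp add: splitting_EC_def)
    then have c: "continuous_map X' T (\<lambda>f. f)"
      by (rule continuous_map_eq) (simp add: X'(3))
    have f0: "assoc_map Y g x0 \<in> topspace X'" using X'(1) x0 by blast
    show ?thesis
    proof (intro conjI allI impI)
      show "assoc_map Y g x0 \<in> topspace T"
        using c f0 by (auto simp: continuous_map_def)
      fix W assume W: "openin T W \<and> assoc_map Y g x0 \<in> W"
      then have "openin X' {f \<in> topspace X'. f \<in> W}"
        using c by (auto simp: continuous_map_def)
      with W f0 obtain A where "openin X A" "x0 \<in> A"
        "assoc_map Y g ` A \<subseteq> {f \<in> topspace X'. f \<in> W}"
        using X'(4)[rule_format, of "{f \<in> topspace X'. f \<in> W}"] by blast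
      then show "\<exists>A. openin X A \<and> x0 \<in> A \<and> assoc_map Y g ` A \<subseteq> W"
        by blast
    qed
  qed
  show "continuous_map X T (assoc_map Y g)"
    unfolding continuous_map_def
  proof (intro conjI allI impI)
    show "assoc_map Y g \<in> topspace X \<rightarrow> topspace T" using loc by blast
    fix W assume W: "openin T W"
    show "openin X {x \<in> topspace X. assoc_map Y g x \<in> W}"
    proof (subst openin_subopen, intro ballI)
      fix x assume "x \<in> {x \<in> topspace X. assoc_map Y g x \<in> W}"
      with loc W obtain A where "openin X A" "x \<in> A" "assoc_map Y g ` A \<subseteq> W" by blast
      then show "\<exists>A. openin X A \<and> x \<in> A \<and> A \<subseteq> {x \<in> topspace X. assoc_map Y g x \<in> W}"
        using openin_subset by (intro exI[of _ A]) blast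
    qed
  qed
qed

lemma splitting_OZ_all_types:
  fixes Y :: "'y topology" and Z :: "'z set"
  assumes "splitting_OZ TYPE('y \<Rightarrow> 'z) Y Z \<U> N T"
  shows "splitting_OZ TYPE('x) Y Z \<U> N T"
  unfolding splitting_OZ_def upper_semi_continuous_fst_def upper_semi_continuous_def
proof (intro allI impI ballI)
  fix X :: "'x topology" and g U x0 V
  assume g: "equi_continuous (prod_topology X Y) Z \<U> g" and U: "U \<in> \<U>"
    and x0: "x0 \<in> topspace X" and V: "openin T V \<and> assoc_multi Y N g x0 U \<subseteq> V"
  let ?e = "\<lambda>(f, y). f y"
  obtain X' :: "('y \<Rightarrow> 'z) topology" where X':
    "topspace X' = assoc_map Y g ` topspace X"
    "equi_continuous (prod_topology X' Y) Z \<U> ?e"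
    "\<forall>f\<in>topspace X'. assoc_map Y ?e f = f"
    "\<forall>S. openin X' S \<and> assoc_map Y g x0 \<in> S \<longrightarrow>
      (\<exists>A. openin X A \<and> x0 \<in> A \<and> assoc_map Y g ` A \<subseteq> S)"
    by (rule localize_test_space[OF g x0])
  have multi: "assoc_multi Y N ?e (assoc_map Y g x) U = assoc_multi Y N g x U"
    if "x \<in> topspace X" for x
    using X'(1,3) that by (simp add: assoc_multi_def)
  have "upper_semi_continuous X' T (\<lambda>f. assoc_multi Y N ?e f U)"
    using assms X'(2) U unfolding splitting_OZ_def upper_semi_continuous_fst_def by blast
  moreover have "assoc_map Y g x0 \<in> topspace X'" using X'(1) x0 by blast
  ultimately obtain S where S: "openin X' S" "assoc_map Y g x0 \<in> S"
    "\<forall>f\<in>S. assoc_multi Y N ?e f U \<subseteq> V"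
    using V multi[OF x0] unfolding upper_semi_continuous_def by metis
  obtain A where A: "openin X A" "x0 \<in> A" "assoc_map Y g ` A \<subseteq> S"
    using X'(4)[rule_format, of S] S(1,2) by blast
  have "assoc_multi Y N g x U \<subseteq> V" if "x \<in> A" for x
  proof -
    have "x \<in> topspace X" using A(1) that openin_subset by blast
    then show ?thesis using multi S(3) A(3) that by (metis image_subset_iff)
  qed
  with A show "\<exists>S. openin X S \<and> x0 \<in> S \<and> (\<forall>x\<in>S. assoc_multi Y N g x U \<subseteq> V)" by blast
qed

end

theory Submission
  imports Defs
begin

text \<open>
  For \<open>x\<close> in \<open>X\<close>, the function \<open>g\<^sup>*(x)\<close> lies in the subbasic set \<open>(H, U)\<close> iff the value at
  \<open>(x, U)\<close> of the associated multifunction is contained in \<open>H\<close>. So the preimages of subbasic open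
  sets under the associated map are the strong preimages \<open>{x. F x \<subseteq> H}\<close> that must be open for upper
  semicontinuity, and the two conditions agree already for each single \<open>g\<close>.
\<close>

text \<open>A set is open iff it is a neighbourhood of each of its points. For the converse, the
  strong preimage of \<open>V\<close> itself serves as \<open>S\<close>.\<close>

lemma upper_semi_continuous_iff_openin:
  "upper_semi_continuous X W F \<longleftrightarrow>
     (\<forall>V. openin W V \<longrightarrow> openin X {x \<in> topspace X. F x \<subseteq> V})"
proof
  assume F: "upper_semi_continuous X W F"
  show "\<forall>V. openin W V \<longrightarrow> openin X {x \<in> topspace X. F x \<subseteq> V}"
  proof (intro allI impI, subst openin_subopen, intro ballI)
    fix V x
    assume "openin W V" "x \<in> {x \<in> topspace X. F x \<subseteq> V}"
    with F obtain S where "openin X S" "x \<in> S" "\<forall>x'\<in>S. F x' \<subseteq> V"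
      unfolding upper_semi_continuous_def by (metis (mono_tags, lifting) mem_Collect_eq)
    then show "\<exists>S. openin X S \<and> x \<in> S \<and> S \<subseteq> {x \<in> topspace X. F x \<subseteq> V}"
      using openin_subset by blast
  qed
next
  assume "\<forall>V. openin W V \<longrightarrow> openin X {x \<in> topspace X. F x \<subseteq> V}"
  then show "upper_semi_continuous X W F"
    unfolding upper_semi_continuous_def by blast
qed

text \<open>Equi-continuity of \<open>g\<close> already puts \<open>assoc_map Y g x\<close> in
  \<open>EC Y Z \<U>\<close>, so only the condition on the chosen neighbourhoods remains.\<close>

lemma assoc_map_in_dual_set_iff:
  assumes "equi_continuous (prod_topology X Y) Z \<U> g" and "x \<in> topspace X"
  shows "assoc_map Y g x \<in> dual_set Y Z \<U> N H U \<longleftrightarrow> assoc_multi Y N g x U \<subseteq> H"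
  using assoc_map_in_EC[OF assms] by (auto simp: dual_set_def assoc_multi_def)

lemma continuous_map_dual_topology_iff:
  assumes "\<U> \<noteq> {}" and "topspace T = OZ Y Z \<U> N"
    and g: "equi_continuous (prod_topology X Y) Z \<U> g"
  shows "continuous_map X (dual_topology Y Z \<U> N T) (assoc_map Y g) \<longleftrightarrow>
         upper_semi_continuous_fst X \<U> T (assoc_multi Y N g)"
proof -
  have preimage: "assoc_map Y g -` dual_set Y Z \<U> N H U \<inter> topspace X =
      {x \<in> topspace X. assoc_multi Y N g x U \<subseteq> H}" for H U
    using assoc_map_in_dual_set_iff[OF g] by auto
  let ?B = "{dual_set Y Z \<U> N H U | H U. openin T H \<and> U \<in> \<U>}"
  \<comment> \<open>Continuity into a generated topology can be tested on the subbasis once the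
    image lies in its union.\<close>
  have "\<Union>?B = EC Y Z \<U>"
    using topspace_dual_topology[OF assms(1,2)]
    by (simp add: dual_topology_def topology_generated_by_topspace)
  then have "assoc_map Y g ` topspace X \<subseteq> \<Union>?B"
    using assoc_map_in_EC[OF g] by (simp only: image_subset_iff) simp
  then have "continuous_map X (dual_topology Y Z \<U> N T) (assoc_map Y g) \<longleftrightarrow>
      (\<forall>S\<in>?B. openin X (assoc_map Y g -` S \<inter> topspace X))"
    unfolding dual_topology_def continuous_on_generated_topo_iff by simp
  also have "\<dots> \<longleftrightarrow>
      (\<forall>U\<in>\<U>. \<forall>H. openin T H \<longrightarrow>
        openin X (assoc_map Y g -` dual_set Y Z \<U> N H U \<inter> topspace X))"
    by blast
  finally show ?thesis
    by (simp add: preimage upper_semi_continuous_fst_def upper_semi_continuous_iff_openin)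
qed

theorem theorem5p9:
  fixes Y :: "'y topology" and Z :: "'z set" and \<U> :: "('z \<times> 'z) set set"
    and N :: "('z \<times> 'z) set \<Rightarrow> ('y \<Rightarrow> 'z) \<Rightarrow> 'y \<Rightarrow> 'y set"
    and T :: "'y set topology"
  assumes "uniform_structure Z \<U>"
    and "neighbourhood_choice Y Z \<U> N"
    and "topspace T = OZ Y Z \<U> N"
  shows "splitting_OZ TYPE('x) Y Z \<U> N T \<longleftrightarrow>
         splitting_EC TYPE('x) Y Z \<U> (dual_topology Y Z \<U> N T)"
proof -
  \<comment> \<open>Any entourage \<open>U\<close> yields the subbasic set
    \<open>dual_set Y Z \<U> N (topspace T) U\<close>, which is all of
    \<open>EC Y Z \<U>\<close>.\<close>
  have "\<U> \<noteq> {}"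
    using assms(1) by (simp add: uniform_structure_def)
  then show ?thesis
    unfolding splitting_OZ_def splitting_EC_def
    by (simp add: continuous_map_dual_topology_iff[OF _ assms(3)])
qed

end
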